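(* Let $n\geq 6$ be an integer. Then the graph $L(n)$ is vertex-pancyclic: for every vertex $v$ of $L(n)$ and every integer $l$ with $3\leq l\leq n(n-1)$, there is a cycle of length $l$ in $L(n)$ containing $v$.
   Context: Let $n\geq 3$ and $[n]=\{1,2,\dots,n\}$. The graph $B(n)$ has vertex set $\{v : v\subset [n],\ |v|\in\{1,2\}\}$, and two vertices $v,w$ are adjacent iff $v\subset w$ or $w\subset v$. The graph $L(n)$ is the line graph of $B(n)$. Equivalently, the vertices of $L(n)$ are the pairs $[i,ij]:=\{\{i\},\{i,j\}\}$ with $i,j\in[n]$, $i\neq j$ (so $L(n)$ has $n(n-1)$ vertices), and two distinct vertices $[i,ij]$ and $[r,rs]$ are adjacent iff $i=r$ or $\{i,j\}=\{r,s\}$. A graph of order $N>2$ is vertex-pancyclic if every vertex lies on a cycle of length $l$ for every $l$ with $3\leq l\leq N$. *)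

theory Defs
  imports "Graph_Theory.Pair_Digraph"
begin

text \<open>
  Finite simple graphs are loop-free symmetric digraphs in the sense of \<^locale>\<open>pair_graph\<close>:
  an edge \<open>{u, v}\<close> is the pair of arcs \<open>(u, v)\<close> and \<open>(v, u)\<close>.
\<close>

definition B_graph :: "nat \<Rightarrow> nat set pair_pre_digraph" where
  "B_graph n =
    (let V = {v. v \<subseteq> {1..n} \<and> card v \<in> {1, 2}}
     in \<lparr>pverts = V, parcs = {(v, w). v \<in> V \<and> w \<in> V \<and> (v \<subset> w \<or> w \<subset> v)}\<rparr>)"

definition line_graph :: "'a pair_pre_digraph \<Rightarrow> 'a set pair_pre_digraph" where
  "line_graph G =
    (let E = {{u, v} | u v. (u, v) \<in> parcs G}
     in \<lparr>pverts = E, parcs = {(e, f). e \<in> E \<and> f \<in> E \<and> e \<noteq> f \<and> e \<inter> f \<noteq> {}}\<rparr>)"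

definition L_graph :: "nat \<Rightarrow> nat set set pair_pre_digraph" where
  "L_graph n = line_graph (B_graph n)"

text \<open>
  \<^const>\<open>pre_digraph.cycle\<close> also admits \<open>a, b, a\<close>, which is not a cycle of an undirected graph;
  the bound \<open>3 \<le> l\<close> excludes it. A cycle is given by its nonempty list \<open>p\<close> of arcs, so its
  vertices are the tails \<open>fst ` set p\<close> and its length is \<^term>\<open>length p\<close>.
\<close>

definition vertex_pancyclic :: "'a pair_pre_digraph \<Rightarrow> bool" where
  "vertex_pancyclic G \<longleftrightarrow>
    card (pverts G) > 2 \<and>
    (\<forall>v \<in> pverts G. \<forall>l. 3 \<le> l \<and> l \<le> card (pverts G) \<longrightarrow>
      (\<exists>p. pre_digraph.cycle (with_proj G) p \<and> length p = l \<and> v \<in> fst ` set p))"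

lemma B_graph_arc_iff:
  "(v, w) \<in> parcs (B_graph n) \<longleftrightarrow>
    (\<exists>i j. i \<in> {1..n} \<and> j \<in> {1..n} \<and> i \<noteq> j \<and>
      (v = {i} \<and> w = {i, j} \<or> w = {i} \<and> v = {i, j}))" (is "?L \<longleftrightarrow> ?R")
proof
  have *: "\<exists>i j. i \<in> {1..n} \<and> j \<in> {1..n} \<and> i \<noteq> j \<and> v = {i} \<and> w = {i, j}"
    if "v \<subset> w" "w \<subseteq> {1..n}" "card v \<in> {1, 2}" "card w \<in> {1, 2}" for v w :: "nat set"
  proof -
    have "finite w" using that(2) finite_subset by blast
    then have "card v < card w" using that(1) psubset_card_mono by blast
    then have "card v = 1" "card w = 2" using that(3,4) by auto
    then obtain i a b where "v = {i}" "w = {a, b}" "a \<noteq> b"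
      by (metis card_1_singletonE card_2_iff)
    then show ?thesis using that(1,2) by (auto simp: insert_commute)
  qed
  assume ?L
  then show ?R
    using *[of v w] *[of w v] unfolding B_graph_def Let_def by simp blast
next
  assume ?R
  then show ?L unfolding B_graph_def Let_def by auto
qed

lemma pverts_L_graph:
  "pverts (L_graph n) = {{{i}, {i, j}} | i j. i \<in> {1..n} \<and> j \<in> {1..n} \<and> i \<noteq> j}"
  unfolding L_graph_def line_graph_def Let_def B_graph_arc_iff
  by (simp, safe) (metis insert_commute | blast)+

lemma parcs_L_graph:
  assumes "i \<in> {1..n}" "j \<in> {1..n}" "i \<noteq> j" "r \<in> {1..n}" "s \<in> {1..n}" "r \<noteq> s"
  shows "({{i}, {i, j}}, {{r}, {r, s}}) \<in> parcs (L_graph n) \<longleftrightarrow>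
    (i, j) \<noteq> (r, s) \<and> (i = r \<or> {i, j} = {r, s})"
proof -
  have V: "{{i}, {i, j}} \<in> pverts (L_graph n)" "{{r}, {r, s}} \<in> pverts (L_graph n)"
    using assms unfolding pverts_L_graph by blast+
  have "(e, f) \<in> parcs (L_graph n) \<longleftrightarrow>
      e \<in> pverts (L_graph n) \<and> f \<in> pverts (L_graph n) \<and> e \<noteq> f \<and> e \<inter> f \<noteq> {}" for e f
    by (simp add: L_graph_def line_graph_def Let_def)
  then show ?thesis using V assms by (auto simp: doubleton_eq_iff)
qed

lemma card_pverts_L_graph: "card (pverts (L_graph n)) = n * (n - 1)"
proof -
  let ?P = "SIGMA i:{1..n}. {1..n} - {i}"
  have "pverts (L_graph n) = (\<lambda>(i, j). {{i}, {i, j}}) ` ?P"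
  proof (rule equalityI, rule_tac [2] image_subsetI, rule subsetI)
    fix e assume "e \<in> pverts (L_graph n)"
    then obtain i j where "e = {{i}, {i, j}}" "(i, j) \<in> ?P"
      unfolding pverts_L_graph by force
    then show "e \<in> (\<lambda>(i, j). {{i}, {i, j}}) ` ?P" by (metis (mono_tags) case_prod_conv imageI)
  next
    fix z assume z: "z \<in> ?P"
    obtain i j where "z = (i, j)" by (cases z)
    then show "(case z of (i, j) \<Rightarrow> {{i}, {i, j}}) \<in> pverts (L_graph n)"
      using z unfolding pverts_L_graph by auto
  qed
  moreover have "inj_on (\<lambda>(i, j). {{i}, {i, j}}) ?P"
  proof (rule inj_onI)
    fix x y :: "nat \<times> nat"
    assume "(case x of (i, j) \<Rightarrow> {{i}, {i, j}}) = (case y of (i, j) \<Rightarrow> {{i}, {i, j}})"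
    then show "x = y" by (cases x; cases y) (auto simp: doubleton_eq_iff)
  qed
  moreover have "card ?P = n * (n - 1)"
    by (subst card_SigmaI) auto
  ultimately show ?thesis by (simp add: card_image)
qed

lemma pair_graph_L_graph: "pair_graph (L_graph n)"
proof -
  have fin: "finite (pverts (L_graph n))"
  proof (rule finite_subset)
    show "pverts (L_graph n) \<subseteq> Pow (Pow {1..n})" unfolding pverts_L_graph by auto
  qed simp
  have arcs: "(e, f) \<in> parcs (L_graph n) \<longleftrightarrow>
      e \<in> pverts (L_graph n) \<and> f \<in> pverts (L_graph n) \<and> e \<noteq> f \<and> e \<inter> f \<noteq> {}" for e f
    by (simp add: L_graph_def line_graph_def Let_def)
  have "parcs (L_graph n) \<subseteq> pverts (L_graph n) \<times> pverts (L_graph n)"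
    using arcs by auto
  then have "finite (parcs (L_graph n))" using fin finite_subset by blast
  then show ?thesis
    using fin by unfold_locales (auto simp: arcs symmetric_def sym_def)
qed

end

theory Submission
  imports Defs "Graph_Theory.Vertex_Walk" "HOL-Library.Disjoint_Sets"
begin

text \<open>
  If a cycle uses an arc inside a clique, it can be rerouted through any missing vertex of that
  clique, and the new cycle again uses arcs inside the clique. Hence a cycle that uses an arc inside
  each of several disjoint cliques grows in steps of one until it has swallowed all of them.

  In \<open>L(n)\<close> the vertices \<open>[i,ij]\<close> with fixed \<open>i\<close> form a clique of size \<open>n - 1\<close>. A triangle inside
  one of these cliques grows through the lengths \<open>3, \<dots>, n - 1\<close>. A cycle of length \<open>k \<ge> 3\<close> in the
  complete graph on \<open>[n]\<close> traces out a cycle of length \<open>2 k\<close> in \<open>L(n)\<close> that uses an arc inside \<open>k\<close>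
  of the cliques, so it grows through the lengths \<open>2 k, \<dots>, k (n - 1)\<close>. For \<open>n \<ge> 6\<close> the ranges
  obtained from the triangle, from \<open>k = 3\<close> and from \<open>k = n\<close> leave no gap.
\<close>

section \<open>Cycles as vertex lists\<close>

definition cyclic_arcs :: "'a vwalk \<Rightarrow> ('a \<times> 'a) list" where
  "cyclic_arcs p = vwalk_arcs (last p # p)"

definition vcycle :: "'a vwalk \<Rightarrow> ('a, 'b) pre_digraph \<Rightarrow> bool" where
  "vcycle p G \<longleftrightarrow> vwalk (last p # p) G \<and> distinct p \<and> p \<noteq> []"

lemma vcycle_iff:
  "vcycle p G \<longleftrightarrow>
    p \<noteq> [] \<and> distinct p \<and> set p \<subseteq> verts G \<and> set (cyclic_arcs p) \<subseteq> arcs_ends G"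
  unfolding vcycle_def vwalk_def cyclic_arcs_def by (auto dest: last_in_set)

lemma length_cyclic_arcs: "length (cyclic_arcs p) = length p"
  unfolding cyclic_arcs_def vwalk_length_def[symmetric] by simp

lemma fst_set_vwalk_arcs: "fst ` set (vwalk_arcs p) = set (butlast p)"
  by (induction p rule: vwalk_arcs.induct) auto

lemma fst_set_cyclic_arcs: "fst ` set (cyclic_arcs p) = set p"
  by (cases p rule: rev_cases) (auto simp: cyclic_arcs_def fst_set_vwalk_arcs)

lemma in_set_cyclic_arcsD:
  assumes "(a, b) \<in> set (cyclic_arcs p)"
  shows "a \<in> set p" and "b \<in> set p"
proof -
  have "p \<noteq> []" using assms by (auto simp: cyclic_arcs_def)
  then show "a \<in> set p" "b \<in> set p"
    using assms arcs_in_vwalk_arcs[of "(a, b)" "last p # p"] by (auto simp: cyclic_arcs_def)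
qed

lemma vwalk_arcs_distinct_neq:
  assumes "distinct p" "(a, b) \<in> set (vwalk_arcs p)"
  shows "a \<noteq> b"
  using assms by (induction p rule: vwalk_arcs.induct) auto

lemma cyclic_arcs_distinct_neq:
  assumes "distinct p" "2 \<le> length p" "(a, b) \<in> set (cyclic_arcs p)"
  shows "a \<noteq> b"
proof -
  obtain x y q where p: "p = x # y # q"
    using assms(2) by (metis One_nat_def Suc_1 Suc_le_length_iff)
  then have "last p \<noteq> hd p" using assms(1) by auto
  then show ?thesis
    using assms(1,3) vwalk_arcs_distinct_neq[of p a b] by (auto simp: cyclic_arcs_def p)
qed

lemma in_set_vwalk_arcs_decomp:
  assumes "(a, b) \<in> set (vwalk_arcs p)"
  shows "\<exists>q r. p = q @ a # b # r"
  using assms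
proof (induction p rule: vwalk_arcs.induct)
  case (3 x y p)
  then consider (first) "a = x" "b = y" | (later) "(a, b) \<in> set (vwalk_arcs (y # p))" by auto
  then show ?case
  proof cases
    case first
    then show ?thesis by blast
  next
    case later
    with 3 show ?thesis by (metis append_Cons)
  qed
qed auto

lemma cyclic_arcs_subdivide:
  assumes "(a, b) \<in> set (cyclic_arcs p)"
  obtains q where "mset q = mset (w # p)"
    and "set (cyclic_arcs q) \<subseteq> set (cyclic_arcs p) \<union> {(a, w), (w, b)}"
    and "set (cyclic_arcs p) - {(a, b)} \<union> {(a, w), (w, b)} \<subseteq> set (cyclic_arcs q)"
proof -
  obtain r s where closed: "last p # p = r @ a # b # s"
    using in_set_vwalk_arcs_decomp assms unfolding cyclic_arcs_def by metis
  define q where "q = tl (r @ a # w # b # s)"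
  have "last q = last p"
    using arg_cong[OF closed, of last] assms
    by (cases r) (auto simp: q_def cyclic_arcs_def)
  then have closed': "last q # q = r @ a # w # b # s"
    using closed by (cases r) (auto simp: q_def)
  have "add_mset (last p) (mset q) = add_mset (last p) (mset (w # p))"
    using arg_cong[OF closed, of mset] arg_cong[OF closed', of mset] \<open>last q = last p\<close> by simp
  then have "mset q = mset (w # p)" by simp
  moreover have "set (cyclic_arcs p) =
      set (vwalk_arcs (r @ [a])) \<union> {(a, b)} \<union> set (vwalk_arcs (b # s))"
    using vwalk_arcs_append[of "r @ [a]" "b # s"] by (simp add: cyclic_arcs_def closed)
  moreover have "set (cyclic_arcs q) =
      set (vwalk_arcs (r @ [a])) \<union> {(a, w), (w, b)} \<union> set (vwalk_arcs (b # s))"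
    using vwalk_arcs_append[of "r @ [a]" "w # b # s"] by (simp add: cyclic_arcs_def closed')
  ultimately show ?thesis using that[of q] by blast
qed

lemma pcas_vwalk_arcs: "p \<noteq> [] \<Longrightarrow> pcas (hd p) (vwalk_arcs p) (last p)"
  by (induction p rule: vwalk_arcs.induct) auto

lemma pawalk_verts_vwalk_arcs: "p \<noteq> [] \<Longrightarrow> pawalk_verts (hd p) (vwalk_arcs p) = p"
  by (induction p rule: vwalk_arcs.induct) auto

lemma vcycle_imp_cycle:
  fixes G :: "'a pair_pre_digraph"
  assumes "vcycle p G"
  shows "pre_digraph.cycle G (cyclic_arcs p)"
proof -
  have p: "p \<noteq> []" "distinct p" "set p \<subseteq> pverts G" "set (cyclic_arcs p) \<subseteq> parcs G"
    using assms by (simp_all add: vcycle_iff)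
  have "pcas (last p) (cyclic_arcs p) (last p)"
    using pcas_vwalk_arcs[of "last p # p"] p(1) by (simp add: cyclic_arcs_def)
  then have "pre_digraph.awalk G (last p) (cyclic_arcs p) (last p)"
    using p by (auto simp: pre_digraph.awalk_def cas_with_proj_eq)
  moreover have "pawalk_verts (last p) (cyclic_arcs p) = last p # p"
    using pawalk_verts_vwalk_arcs[of "last p # p"] by (simp add: cyclic_arcs_def)
  moreover have "cyclic_arcs p \<noteq> []"
    using p(1) length_cyclic_arcs[of p] by auto
  ultimately show ?thesis
    using p(2) by (auto simp: pre_digraph.cycle_def awalk_verts_with_proj_eq)
qed

section \<open>Growing a cycle inside disjoint cliques\<close>

definition clique :: "'a set \<Rightarrow> ('a, 'b) pre_digraph \<Rightarrow> bool" where
  "clique K G \<longleftrightarrow> K \<subseteq> verts G \<and> (\<forall>u\<in>K. \<forall>v\<in>K. u \<noteq> v \<longrightarrow> (u, v) \<in> arcs_ends G)"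

definition uses_arc_in :: "'a vwalk \<Rightarrow> 'a set \<Rightarrow> bool" where
  "uses_arc_in p K \<longleftrightarrow> (\<exists>a\<in>K. \<exists>b\<in>K. (a, b) \<in> set (cyclic_arcs p))"

lemma vcycle_absorb_vertex:
  assumes "vcycle p G" "disjoint_family_on K I"
    and cliques: "\<And>i. i \<in> I \<Longrightarrow> clique (K i) G"
    and used: "\<And>i. i \<in> I \<Longrightarrow> uses_arc_in p (K i)"
    and w: "w \<in> (\<Union>i\<in>I. K i)" "w \<notin> set p"
  obtains q where "vcycle q G" "\<And>i. i \<in> I \<Longrightarrow> uses_arc_in q (K i)" "set q = insert w (set p)"
proof -
  obtain i where i: "i \<in> I" "w \<in> K i" using w(1) by blast
  obtain a b where ab: "a \<in> K i" "b \<in> K i" "(a, b) \<in> set (cyclic_arcs p)"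
    using used[OF i(1)] by (auto simp: uses_arc_in_def)
  obtain q where mset_q: "mset q = mset (w # p)"
    and upper: "set (cyclic_arcs q) \<subseteq> set (cyclic_arcs p) \<union> {(a, w), (w, b)}"
    and lower: "set (cyclic_arcs p) - {(a, b)} \<union> {(a, w), (w, b)} \<subseteq> set (cyclic_arcs q)"
    using cyclic_arcs_subdivide[OF ab(3)] .
  have set_q: "set q = insert w (set p)"
    using arg_cong[OF mset_q, of set_mset] by simp
  have "w \<in> verts G" "(a, w) \<in> arcs_ends G" "(w, b) \<in> arcs_ends G"
    using cliques[OF i(1)] i(2) ab in_set_cyclic_arcsD[OF ab(3)] w(2) by (auto simp: clique_def)
  moreover have "distinct q"
    using mset_eq_imp_distinct_iff[OF mset_q] assms(1) w(2) by (simp add: vcycle_iff)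
  ultimately have "vcycle q G"
    using assms(1) set_q upper by (auto simp: vcycle_iff)
  moreover have "uses_arc_in q (K j)" if "j \<in> I" for j
  proof (cases "j = i")
    case True
    then show ?thesis using i(2) ab(1) lower by (auto simp: uses_arc_in_def)
  next
    case False
    then have "a \<notin> K j"
      using assms(2) i(1) that ab(1) by (auto dest: disjoint_family_onD)
    then show ?thesis using used[OF that] lower by (auto simp: uses_arc_in_def)
  qed
  ultimately show ?thesis using that set_q by blast
qed

lemma vcycle_extend_in_cliques:
  assumes "vcycle p G" "disjoint_family_on K I"
    and "\<And>i. i \<in> I \<Longrightarrow> clique (K i) G"
    and "\<And>i. i \<in> I \<Longrightarrow> uses_arc_in p (K i)"
    and "length p \<le> l" "l \<le> card (\<Union>i\<in>I. K i)"
  shows "\<exists>q. vcycle q G \<and> (\<forall>i\<in>I. uses_arc_in q (K i)) \<and> set p \<subseteq> set q \<and> length q = l"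
  using assms(5,6)
proof (induction l rule: dec_induct)
  case base
  then show ?case using assms(1,4) by blast
next
  case (step l)
  then obtain q where q: "vcycle q G" "\<And>i. i \<in> I \<Longrightarrow> uses_arc_in q (K i)"
    "set p \<subseteq> set q" "length q = l"
    by auto
  have "card (set q) < card (\<Union>i\<in>I. K i)"
    using q(1,4) step.prems by (simp add: vcycle_iff distinct_card)
  then obtain w where w: "w \<in> (\<Union>i\<in>I. K i)" "w \<notin> set q"
    using card_mono[of "set q" "\<Union>i\<in>I. K i"] by fastforce
  obtain q' where q': "vcycle q' G" "\<And>i. i \<in> I \<Longrightarrow> uses_arc_in q' (K i)" "set q' = insert w (set q)"
    using vcycle_absorb_vertex[OF q(1) assms(2,3) q(2) w] by blast
  moreover have "length q' = Suc l"
    using q(1,4) q'(1,3) w(2) by (metis card_insert_disjoint distinct_card finite_set vcycle_iff)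
  ultimately show ?case using q(3) by blast
qed

section \<open>The flags of \<open>L(n)\<close>\<close>

definition flag :: "'a \<Rightarrow> 'a \<Rightarrow> 'a set set" where
  "flag i j = {{i}, {i, j}}"

definition flags_at :: "nat \<Rightarrow> nat \<Rightarrow> nat set set set" where
  "flags_at n i = flag i ` ({1..n} - {i})"

lemma flag_eq_iff [simp]: "flag i j = flag r s \<longleftrightarrow> i = r \<and> j = s"
  by (auto simp: flag_def doubleton_eq_iff)

lemma pverts_L_graph_eq_flags:
  "pverts (L_graph n) = {flag i j | i j. i \<in> {1..n} \<and> j \<in> {1..n} \<and> i \<noteq> j}"
  unfolding pverts_L_graph flag_def ..

lemma flag_in_pverts_L_graph_iff:
  "flag i j \<in> pverts (L_graph n) \<longleftrightarrow> i \<in> {1..n} \<and> j \<in> {1..n} \<and> i \<noteq> j"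
  by (simp add: pverts_L_graph_eq_flags)

lemma flag_in_flags_at_iff: "flag r j \<in> flags_at n i \<longleftrightarrow> r = i \<and> j \<in> {1..n} \<and> i \<noteq> j"
  by (auto simp: flags_at_def)

lemma flag_arc_in_L_graph_iff:
  assumes "flag i j \<in> pverts (L_graph n)" "flag r s \<in> pverts (L_graph n)"
  shows "(flag i j, flag r s) \<in> parcs (L_graph n) \<longleftrightarrow>
    (i, j) \<noteq> (r, s) \<and> (i = r \<or> i = s \<and> j = r)"
  using assms parcs_L_graph[of i n j r s]
  unfolding flag_in_pverts_L_graph_iff by (auto simp: flag_def doubleton_eq_iff)

lemma clique_flags_at: "i \<in> {1..n} \<Longrightarrow> clique (flags_at n i) (L_graph n)"
  by (auto simp: clique_def flags_at_def flag_in_pverts_L_graph_iff flag_arc_in_L_graph_iff)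

lemma disjoint_family_flags_at: "disjoint_family_on (flags_at n) C"
  by (auto simp: disjoint_family_on_def flags_at_def)

lemma card_UN_flags_at:
  assumes "C \<subseteq> {1..n}"
  shows "card (\<Union>i\<in>C. flags_at n i) = card C * (n - 1)"
proof -
  have card_flags_at: "card (flags_at n i) = n - 1" if "i \<in> C" for i
    using that assms by (auto simp: flags_at_def card_image inj_on_def)
  have "finite C" using assms finite_subset by blast
  then have "card (\<Union>i\<in>C. flags_at n i) = (\<Sum>i\<in>C. card (flags_at n i))"
    by (intro card_UN_disjoint' disjoint_family_flags_at) (auto simp: flags_at_def)
  also have "\<dots> = card C * (n - 1)" using card_flags_at by simp
  finally show ?thesis .
qed

lemma L_graph_vcycle_extend:
  assumes "vcycle p (L_graph n)" "C \<subseteq> {1..n}"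
    and "\<And>i. i \<in> C \<Longrightarrow> uses_arc_in p (flags_at n i)"
    and "length p \<le> l" "l \<le> card C * (n - 1)"
  shows "\<exists>q. vcycle q (L_graph n) \<and> set p \<subseteq> set q \<and> length q = l"
proof -
  have "clique (flags_at n i) (L_graph n)" if "i \<in> C" for i
    using clique_flags_at that assms(2) by blast
  from vcycle_extend_in_cliques[OF assms(1) disjoint_family_flags_at this assms(3,4)] show ?thesis
    using assms(5) card_UN_flags_at[OF assms(2)] by metis
qed

section \<open>The cycle of flags along a cycle of the complete graph\<close>

fun flag_walk :: "'a vwalk \<Rightarrow> 'a set set vwalk" where
  "flag_walk (a # b # p) = flag a b # flag b a # flag_walk (b # p)"
| "flag_walk p = []"

lemma length_flag_walk: "length (flag_walk p) = 2 * (length p - 1)"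
  by (induction p rule: flag_walk.induct) auto

lemma set_flag_walk: "set (flag_walk p) = (\<Union>(a, b)\<in>set (vwalk_arcs p). {flag a b, flag b a})"
  by (induction p rule: flag_walk.induct) auto

lemma flag_in_flag_walkD:
  assumes "flag a b \<in> set (flag_walk p)"
  shows "a \<in> set p" and "b \<in> set p"
  using assms arcs_in_vwalk_arcs[of _ p] by (auto simp: set_flag_walk)

lemma last_flag_walk: "p \<noteq> [] \<Longrightarrow> last (flag_walk (a # p)) = flag (last p) (last (butlast (a # p)))"
  by (induction p arbitrary: a rule: induct_list012) auto

lemma distinct_flag_walk: "distinct p \<Longrightarrow> distinct (flag_walk p)"
proof (induction p rule: flag_walk.induct)
  case (1 a b p)
  then show ?case using flag_in_flag_walkD[of _ _ "b # p"] by auto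
qed auto

lemma flag_walk_arcD:
  assumes "(flag i j, flag r s) \<in> set (vwalk_arcs (flag a z # flag_walk (a # p)))"
  shows "i = r \<or> i = s \<and> j = r"
  using assms by (induction p arbitrary: a z) auto

lemma flag_walk_ex_arc_at:
  assumes "i \<in> set (butlast (a # p))"
  shows "\<exists>d e. (flag i d, flag i e) \<in> set (vwalk_arcs (flag a z # flag_walk (a # p)))"
  using assms
proof (induction p arbitrary: a z)
  case (Cons b p)
  show ?case
  proof (cases "i = a")
    case False
    then show ?thesis using Cons.IH[of b a] Cons.prems by auto
  qed auto
qed simp

definition flag_cycle :: "'a vwalk \<Rightarrow> 'a set set vwalk" where
  "flag_cycle p = flag_walk (last p # p)"

lemma length_flag_cycle: "length (flag_cycle p) = 2 * length p"
  by (simp add: flag_cycle_def length_flag_walk)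

lemma set_flag_cycle: "set (flag_cycle p) = (\<Union>(a, b)\<in>set (cyclic_arcs p). {flag a b, flag b a})"
  by (simp add: flag_cycle_def set_flag_walk cyclic_arcs_def)

lemma distinct_flag_cycle:
  assumes "distinct p" "3 \<le> length p"
  shows "distinct (flag_cycle p)"
proof -
  obtain a b r where p: "p = a # b # r" "r \<noteq> []"
    using assms(2) by (metis Suc_le_length_iff list.distinct(1) numeral_3_eq_3)
  have "last r \<in> set r" using p(2) by simp
  then have "a \<noteq> last r" "b \<noteq> last r" using assms(1) p(1) by auto
  moreover have "a \<notin> set (b # r)" using assms(1) p(1) by simp
  ultimately show ?thesis
    using p distinct_flag_walk[OF assms(1)] flag_in_flag_walkD[of _ _ "b # r"]
    by (auto simp: flag_cycle_def)
qed

lemma cyclic_arcs_flag_cycle: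
  assumes "p \<noteq> []"
  obtains z where "cyclic_arcs (flag_cycle p) = vwalk_arcs (flag (last p) z # flag_walk (last p # p))"
  using last_flag_walk[OF assms] by (simp add: cyclic_arcs_def flag_cycle_def)

lemma set_flag_cycle_subset_L_graph:
  assumes "distinct p" "2 \<le> length p" "set p \<subseteq> {1..n}"
  shows "set (flag_cycle p) \<subseteq> pverts (L_graph n)"
proof
  fix v assume "v \<in> set (flag_cycle p)"
  then obtain a b where "(a, b) \<in> set (cyclic_arcs p)" "v = flag a b \<or> v = flag b a"
    by (auto simp: set_flag_cycle)
  moreover from this(1) have "a \<in> {1..n}" "b \<in> {1..n}" "a \<noteq> b"
    using in_set_cyclic_arcsD[of a b p] cyclic_arcs_distinct_neq[of p a b] assms by auto
  ultimately show "v \<in> pverts (L_graph n)"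
    by (auto simp: flag_in_pverts_L_graph_iff)
qed

lemma vcycle_flag_cycle:
  assumes "distinct p" "3 \<le> length p" "set p \<subseteq> {1..n}"
  shows "vcycle (flag_cycle p) (L_graph n)"
proof -
  have p: "p \<noteq> []" using assms(2) by auto
  have dist: "distinct (flag_cycle p)" by (rule distinct_flag_cycle[OF assms(1,2)])
  have len: "2 \<le> length (flag_cycle p)" using assms(2) by (simp add: length_flag_cycle)
  have verts: "set (flag_cycle p) \<subseteq> pverts (L_graph n)"
    using set_flag_cycle_subset_L_graph assms by auto
  have "(u, v) \<in> parcs (L_graph n)" if uv: "(u, v) \<in> set (cyclic_arcs (flag_cycle p))" for u v
  proof -
    have "u \<in> pverts (L_graph n)" "v \<in> pverts (L_graph n)"
      using in_set_cyclic_arcsD[OF uv] verts by auto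
    moreover from this obtain i j r s where flags: "u = flag i j" "v = flag r s"
      unfolding pverts_L_graph_eq_flags by blast
    moreover have "i = r \<or> i = s \<and> j = r"
      using cyclic_arcs_flag_cycle[OF p] flag_walk_arcD uv unfolding flags by metis
    moreover have "u \<noteq> v" by (rule cyclic_arcs_distinct_neq[OF dist len uv])
    ultimately show ?thesis by (simp add: flag_arc_in_L_graph_iff)
  qed
  then show ?thesis
    using dist len verts by (auto simp: vcycle_iff)
qed

lemma flag_cycle_uses_arc_in_flags_at:
  assumes "distinct p" "2 \<le> length p" "set p \<subseteq> {1..n}" "i \<in> set p"
  shows "uses_arc_in (flag_cycle p) (flags_at n i)"
proof -
  have "p \<noteq> []" and "i \<in> set (butlast (last p # p))"
    using assms(4) by (cases p rule: rev_cases; auto)+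
  then obtain d e where de: "(flag i d, flag i e) \<in> set (cyclic_arcs (flag_cycle p))"
    using cyclic_arcs_flag_cycle flag_walk_ex_arc_at by metis
  then have "flag i d \<in> flags_at n i" "flag i e \<in> flags_at n i"
    using in_set_cyclic_arcsD[OF de] set_flag_cycle_subset_L_graph[OF assms(1-3)]
    by (auto simp: flag_in_flags_at_iff flag_in_pverts_L_graph_iff)
  then show ?thesis using de by (auto simp: uses_arc_in_def)
qed

section \<open>Cycles of all lengths through a flag\<close>

lemma obtain_distinct_list_of_length:
  assumes "m \<le> card A"
  obtains xs where "distinct xs" "set xs \<subseteq> A" "length xs = m"
  using assms by (metis obtain_subset_with_card_n finite_distinct_list distinct_card)

lemma L_graph_vcycle_through_flag_in_clique:
  assumes flag: "flag i j \<in> pverts (L_graph n)" and l: "3 \<le> l" "l \<le> n - 1"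
  shows "\<exists>p. vcycle p (L_graph n) \<and> flag i j \<in> set p \<and> length p = l"
proof -
  have ij: "i \<in> {1..n}" "j \<in> {1..n}" "i \<noteq> j"
    using flag by (auto simp: flag_in_pverts_L_graph_iff)
  then have "2 \<le> card ({1..n} - {i, j})" using l by (simp add: card_Diff_subset)
  then obtain xs where "distinct xs" "set xs \<subseteq> {1..n} - {i, j}" "length xs = 2"
    by (rule obtain_distinct_list_of_length)
  then obtain k m where km: "k \<in> {1..n} - {i, j}" "m \<in> {1..n} - {i, j}" "k \<noteq> m"
    by (auto simp: length_Suc_conv numeral_2_eq_2)
  let ?T = "[flag i j, flag i k, flag i m]"
  have "vcycle ?T (L_graph n)"
    using ij km
    by (auto simp: vcycle_iff cyclic_arcs_def flag_in_pverts_L_graph_iff flag_arc_in_L_graph_iff)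
  moreover have "uses_arc_in ?T (flags_at n i)"
    unfolding uses_arc_in_def
  proof (intro bexI)
    show "(flag i j, flag i k) \<in> set (cyclic_arcs ?T)" by (simp add: cyclic_arcs_def)
  qed (use ij km in \<open>auto simp: flag_in_flags_at_iff\<close>)
  ultimately show ?thesis
    using L_graph_vcycle_extend[of ?T n "{i}" l] ij(1) l by auto
qed

lemma L_graph_vcycle_through_flag_across_cliques:
  assumes flag: "flag i j \<in> pverts (L_graph n)" and k: "3 \<le> k" "k \<le> n"
    and l: "2 * k \<le> l" "l \<le> k * (n - 1)"
  shows "\<exists>p. vcycle p (L_graph n) \<and> flag i j \<in> set p \<and> length p = l"
proof -
  have ij: "i \<in> {1..n}" "j \<in> {1..n}" "i \<noteq> j"
    using flag by (auto simp: flag_in_pverts_L_graph_iff)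
  then have "k - 2 \<le> card ({1..n} - {i, j})" using k(2) by (simp add: card_Diff_subset)
  then obtain r where r: "distinct r" "set r \<subseteq> {1..n} - {i, j}" "length r = k - 2"
    by (rule obtain_distinct_list_of_length)
  let ?c = "i # j # r"
  have c: "distinct ?c" "3 \<le> length ?c" "set ?c \<subseteq> {1..n}" "length ?c = k"
    using r ij k(1) by auto
  have "uses_arc_in (flag_cycle ?c) (flags_at n t)" if "t \<in> set ?c" for t
    using flag_cycle_uses_arc_in_flags_at that c by simp
  moreover have "length (flag_cycle ?c) \<le> l" "l \<le> card (set ?c) * (n - 1)"
    using l c distinct_card[OF c(1)] by (simp_all add: length_flag_cycle)
  ultimately obtain p where "vcycle p (L_graph n)" "set (flag_cycle ?c) \<subseteq> set p" "length p = l"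
    using L_graph_vcycle_extend[OF vcycle_flag_cycle[OF c(1-3)] c(3)] by blast
  moreover have "flag i j \<in> set (flag_cycle ?c)" by (simp add: flag_cycle_def)
  ultimately show ?thesis by blast
qed

lemma L_graph_vcycle_through_flag:
  assumes "6 \<le> n" "flag i j \<in> pverts (L_graph n)" "3 \<le> l" "l \<le> n * (n - 1)"
  shows "\<exists>p. vcycle p (L_graph n) \<and> flag i j \<in> set p \<and> length p = l"
proof -
  consider "l \<le> n - 1" | "2 * 3 \<le> l" "l \<le> 3 * (n - 1)" | "2 * n \<le> l"
    using assms(1) by linarith
  then show ?thesis
    using L_graph_vcycle_through_flag_in_clique
      L_graph_vcycle_through_flag_across_cliques[where k = 3]
      L_graph_vcycle_through_flag_across_cliques[where k = n] assms
    by cases auto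
qed

theorem theorem2p3:
  fixes n :: nat
  assumes "n \<ge> 6"
  shows "vertex_pancyclic (L_graph n)"
  unfolding vertex_pancyclic_def card_pverts_L_graph
proof (intro conjI ballI allI impI)
  have "6 * 5 \<le> n * (n - 1)" using assms by (intro mult_le_mono) auto
  then show "2 < n * (n - 1)" by simp
next
  fix v l
  assume "v \<in> pverts (L_graph n)" and l: "3 \<le> l \<and> l \<le> n * (n - 1)"
  moreover then obtain i j where "v = flag i j"
    unfolding pverts_L_graph_eq_flags by blast
  ultimately obtain p where "vcycle p (L_graph n)" "v \<in> set p" "length p = l"
    using L_graph_vcycle_through_flag[OF assms] by blast
  then show "\<exists>p. pre_digraph.cycle (L_graph n) p \<and> length p = l \<and> v \<in> fst ` set p"
    using vcycle_imp_cycle length_cyclic_arcs fst_set_cyclic_arcs by metis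
qed

end
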